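(* Let $d,M,\nu\ge 1$, let $A\in\mathbb{R}^{d\times d}$ be a constant matrix and let $g_0,g_1,\dots,g_M\in C^\infty(\mathbb{R}^d,\mathbb{R}^d)$. Consider one step, with step size $h$ and starting from $Y_n\in\mathbb{R}^d$, of the $\nu$-stage stochastic exponential integrator $$H_i=\mathrm{e}^{c_ihA}Y_n+\sum_{m=0}^{M}\sum_{j=1}^{\nu}Z_{ij}^{(m)}(A)\cdot g_m(H_j),\qquad i=1,\dots,\nu,$$ $$Y_{n+1}=\mathrm{e}^{hA}Y_n+\sum_{m=0}^{M}\sum_{i=1}^{\nu}z_i^{(m)}(A)\cdot g_m(H_i),$$ where $c_1,\dots,c_\nu\in\mathbb{R}$ and where the coefficients can be expressed as power series in $A$, $$Z_{ij}^{(m)}(A)=\sum_{q=0}^{\infty}Z_{ij}^{(m,q)}A^q,\qquad z_i^{(m)}(A)=\sum_{q=0}^{\infty}z_i^{(m,q)}A^q,$$ with (in general $h$-dependent) real random variables $Z_{ij}^{(m,q)}$, $z_i^{(m,q)}$ for $i,j=1,\dots,\nu$, $m=0,\dots,M$, $q=0,1,\dots$. Then the stage values $H_i$ and the numerical solution $Y_{n+1}$ can be written (in the sense of formal series explained in the context) as B-series $$H_i=B(\Phi_i,Y_n;h),\quad i=1,\dots,\nu,\qquad Y_{n+1}=B(\Phi,Y_n;h),$$ with the following recurrence relations for the functions $\Phi_i(\tau)(h)$ and $\Phi(\tau)(h)$: $$\Phi_i(\emptyset)=\Phi(\emptyset)\equiv1,\qquad \Phi_i([\emptyset]_A^{q})(h)=\frac{(c_ih)^q}{q!},\qquad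 \Phi([\emptyset]_A^{q})(h)=\frac{h^q}{q!},$$ $$\Phi_i\big([[\tau_1,\dots,\tau_\kappa]_m]_A^{q}\big)(h)=\sum_{j=1}^{\nu}Z_{ij}^{(m,q)}\prod_{k=1}^{\kappa}\Phi_j(\tau_k)(h),$$ $$\Phi\big([[\tau_1,\dots,\tau_\kappa]_m]_A^{q}\big)(h)=\sum_{i=1}^{\nu}z_i^{(m,q)}\prod_{k=1}^{\kappa}\Phi_i(\tau_k)(h),$$ for all $\tau_1,\dots,\tau_\kappa\in T$, $\kappa=0,1,\dots$, $q=0,1,\dots$ and $m=0,\dots,M$, where $\tau_i\neq\emptyset$ for $i=1,\dots,\kappa$ if $\kappa>1$.
   Context: **Trees.** The set of $(M+2)$-colored rooted trees $T=\{\emptyset\}\cup T_0\cup T_1\cup\dots\cup T_M\cup T_A$ is defined recursively. For $m=0,\dots,M$: the one-vertex tree $\bullet_m=[\emptyset]_m$ of color $m$ belongs to $T_m$, and the one-vertex tree $\bullet_A=[\emptyset]_A$ of color $A$ belongs to $T_A$. If $\tau_1,\dots,\tau_\kappa\in T$, then the tree $[\tau_1,\dots,\tau_\kappa]_m$, formed by joining the subtrees $\tau_1,\dots,\tau_\kappa$ each by a single branch to a common root of color $m$, belongs to $T_m$, and the tree $[\tau_1]_A$, formed by joining the single subtree $\tau_1$ to a root of color $A$, belongs to $T_A$ (so a node of color $A$ has at most one branch). The order of the subtrees is irrelevant. For $\kappa=0$, and for $\kappa=1$ with $\tau_1=\emptyset$, $[\tau_1,\dots,\tau_\kappa]_m$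 means $\bullet_m$; for $\kappa>1$ all subtrees are nonempty. For $q\ge 0$, $[\hat\tau]_A^{q}$ denotes the tree obtained from $\hat\tau$ by applying $\tau\mapsto[\tau]_A$ $q$ times, with $[\hat\tau]_A^0=\hat\tau$. Every $\tau\in T$ is $[\hat\tau]_A^q$ for a unique $q\geq 0$ and a unique $\hat\tau\in T\setminus T_A$. Empty products equal $1$. **Elementary differentials.** $F(\tau):\mathbb{R}^d\to\mathbb{R}^d$ is defined by $F(\emptyset)(x)=x$, $F(\bullet_m)(x)=g_m(x)$, $F(\bullet_A)(x)=Ax$, $F([\tau_1]_A)(x)=AF(\tau_1)(x)$, and, for nonempty subtrees, $F([\tau_1,\dots,\tau_\kappa]_m)(x)=g_m^{(\kappa)}(x)\big(F(\tau_1)(x),\dots,F(\tau_\kappa)(x)\big)$, where $g_m^{(\kappa)}$ is the $\kappa$-th derivative. **B-series.** A (stochastic) B-series is a formal series $B(\phi,x_0;h)=\sum_{\tau\in T}\alpha(\tau)\cdot\phi(\tau)(h)\cdot F(\tau)(x_0)$, where $\phi(\tau)(h)$ is a random variable with $\phi(\emptyset)\equiv1$ and $\phi(\tau)(0)=0$ for $\tau\in T\setminus\{\emptyset\}$, and $\alpha:T\to\mathbb{Q}$ is given by $\alpha(\emptyset)=\alpha(\bullet_m)=\alpha(\bullet_A)=1$, $\alpha([\tau_1]_A)=\alpha(\tau_1)$, and $\alpha([\tau_1,\dots,\tau_\kappa]_m)=\frac{1}{r_1!r_2!\cdots r_l!}\prod_{k=1}^\kappa\alpha(\tau_k)$, where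 $r_1,\dots,r_l$ count equal trees among $\tau_1,\dots,\tau_\kappa$. **Meaning of "can be written as B-series".** The statement is one about formal series; no convergence is claimed. The equations defining $H_1,\dots,H_\nu$ and $Y_{n+1}$ hold, as identities of formal series indexed by $\tau\in T$ (coefficient by coefficient), when $H_i$ is replaced by $B(\Phi_i,Y_n;h)$ and $Y_{n+1}$ by $B(\Phi,Y_n;h)$. Here $g_m$ of a B-series is understood through formal Taylor expansion of $g_m$ about $x_0$ (with $x_0=Y_n$), that is, as the formal series $$g_m(B(\phi,x_0;h))=\sum_{\tau\in T_m}\alpha(\tau)\cdot\phi_m'(\tau)(h)\cdot F(\tau)(x_0),$$ with $\phi_m'(\bullet_m)(h)=1$ and $\phi_m'([\tau_1,\dots,\tau_\kappa]_m)(h)=\prod_{k=1}^\kappa\phi(\tau_k)(h)$; the exponentials are understood as $\mathrm{e}^{tA}=\sum_{q\ge0}\frac{t^q}{q!}A^q$; sums are taken termwise; and the term $A^qF(\tau)(x_0)$ is identified with $F([\tau]_A^q)(x_0)$. **Background.** The scheme is meant as a numerical method for the SDE $\mathrm{d}X=(AX+g_0(X))\,\mathrm{d}t+\sum_{m=1}^M g_m(X)\star\mathrm{d}W_m$ (Itô or Stratonovich); the random coefficients typically depend on $h$, $A$ and the Wiener processes.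
   Formalization: The B-series condition that φ(τ)(0)=0 for nonempty τ fails for general coefficients (e.g. Z constant 1), so it is concluded only when the coefficients Z (for the stages) or z (for the numerical solution) vanish at h=0; everything else is proved without this. *)

theory Defs
  imports "HOL-Probability.Probability"
begin

section \<open>Coloured rooted trees\<close>

text \<open>
  The multiset in \<open>NodeG\<close> makes the order of the subtrees irrelevant. The empty tree is a value of the
  type, so that the one-vertex tree of colour \<open>A\<close> is literally \<open>NodeA EmptyTree\<close>. The type
  contains junk (colours above \<open>M\<close>, empty trees below a \<open>NodeG\<close>), which the set \<open>ctrees M\<close> excludes.
\<close>

datatype ctree = EmptyTree | NodeG nat "ctree multiset" | NodeA ctree

inductive_set ctrees :: "nat \<Rightarrow> ctree set" for M :: nat where
  "EmptyTree \<in> ctrees M"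
| "m \<le> M \<Longrightarrow> (\<And>\<tau>. \<tau> \<in># ts \<Longrightarrow> \<tau> \<in> ctrees M \<and> \<tau> \<noteq> EmptyTree) \<Longrightarrow> NodeG m ts \<in> ctrees M"
| "\<tau> \<in> ctrees M \<Longrightarrow> NodeA \<tau> \<in> ctrees M"

text \<open>
  \<open>graft m [\<tau>\<^sub>1, \<dots>, \<tau>\<^sub>\<kappa>]\<close> is the tree written \<open>[\<tau>\<^sub>1, \<dots>, \<tau>\<^sub>\<kappa>]\<^sub>m\<close>. It is used only for lists that contain
  \<open>EmptyTree\<close> at most when \<open>\<kappa> = 1\<close>; dropping empty trees then says that \<open>[\<emptyset>]\<^sub>m\<close> is the one-vertex tree.
\<close>

definition graft :: "nat \<Rightarrow> ctree list \<Rightarrow> ctree" where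
  "graft m ts = NodeG m (mset (filter (\<lambda>\<tau>. \<tau> \<noteq> EmptyTree) ts))"

abbreviation graftA_pow :: "nat \<Rightarrow> ctree \<Rightarrow> ctree" where
  "graftA_pow q \<tau> \<equiv> (NodeA ^^ q) \<tau>"

primrec alpha :: "ctree \<Rightarrow> rat" where
  "alpha EmptyTree = 1"
| "alpha (NodeG m ts) =
     prod_mset (image_mset alpha ts) / (\<Prod>\<tau>\<in>set_mset ts. fact (count ts \<tau>))"
| "alpha (NodeA \<tau>) = alpha \<tau>"


section \<open>Higher derivatives and elementary differentials\<close>

text \<open>\<open>nderiv f [v\<^sub>1, \<dots>, v\<^sub>\<kappa>] x\<close> is \<open>f\<^sup>(\<^sup>\<kappa>\<^sup>)(x)(v\<^sub>1, \<dots>, v\<^sub>\<kappa>)\<close> for smooth \<open>f\<close>.\<close>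

primrec nderiv ::
  "('a::real_normed_vector \<Rightarrow> 'b::real_normed_vector) \<Rightarrow> 'a list \<Rightarrow> 'a \<Rightarrow> 'b" where
  "nderiv f [] = f"
| "nderiv f (v # vs) = (\<lambda>x. frechet_derivative (nderiv f vs) (at x) v)"

definition smooth :: "('a::real_normed_vector \<Rightarrow> 'b::real_normed_vector) \<Rightarrow> bool" where
  "smooth f \<longleftrightarrow> (\<forall>vs x. nderiv f vs differentiable (at x))"

text \<open>
  The directions are given as a multiset and are put into an arbitrary order. For smooth functions
  the order does not matter, see \<open>nderiv_mset_eq\<close> and \<open>eldiff_NodeG_mset\<close> below.
\<close>

definition nderiv_mset ::
  "('a::real_normed_vector \<Rightarrow> 'b::real_normed_vector) \<Rightarrow> 'a multiset \<Rightarrow> 'a \<Rightarrow> 'b" where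
  "nderiv_mset f V x = nderiv f (SOME vs. mset vs = V) x"

primrec eldiff ::
  "real ^ 'd ^ 'd \<Rightarrow> (nat \<Rightarrow> real ^ 'd \<Rightarrow> real ^ 'd) \<Rightarrow> ctree \<Rightarrow> real ^ 'd \<Rightarrow> real ^ 'd" where
  "eldiff A g EmptyTree = (\<lambda>x. x)"
| "eldiff A g (NodeG m ts) =
     (\<lambda>x. nderiv_mset (g m) (image_mset (\<lambda>f. f x) (image_mset (eldiff A g) ts)) x)"
| "eldiff A g (NodeA \<tau>) = (\<lambda>x. A *v eldiff A g \<tau> x)"

lemma second_difference_mvt:
  fixes f :: "'a::real_normed_vector \<Rightarrow> real"
  assumes u: "\<And>y. ((\<lambda>t. f (y + t *\<^sub>R u)) has_real_derivative fu y) (at 0)"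
    and uv: "\<And>y. ((\<lambda>t. fu (y + t *\<^sub>R v)) has_real_derivative fuv y) (at 0)"
    and s: "s > 0"
  shows "\<exists>p r. 0 < p \<and> p < s \<and> 0 < r \<and> r < s \<and>
    f (x + s *\<^sub>R u + s *\<^sub>R v) - f (x + s *\<^sub>R u) - f (x + s *\<^sub>R v) + f x
      = s * s * fuv (x + p *\<^sub>R u + r *\<^sub>R v)"
proof -
  have u': "((\<lambda>t. f (y + t *\<^sub>R u)) has_real_derivative fu (y + t *\<^sub>R u)) (at t)" for y t
    using u[of "y + t *\<^sub>R u"] DERIV_shift[of "\<lambda>t. f (y + t *\<^sub>R u)" _ 0 t]
    by (simp add: scaleR_add_left add.assoc add.commute[of t] add.commute[of "t *\<^sub>R u"])
  have uv': "((\<lambda>t. fu (y + t *\<^sub>R v)) has_real_derivative fuv (y + t *\<^sub>R v)) (at t)" for y t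
    using uv[of "y + t *\<^sub>R v"] DERIV_shift[of "\<lambda>t. fu (y + t *\<^sub>R v)" _ 0 t]
    by (simp add: scaleR_add_left add.assoc add.commute[of t] add.commute[of "t *\<^sub>R v"])
  define G where "G t = f (x + s *\<^sub>R v + t *\<^sub>R u) - f (x + t *\<^sub>R u)" for t
  have "DERIV G t :> fu (x + s *\<^sub>R v + t *\<^sub>R u) - fu (x + t *\<^sub>R u)" for t
    unfolding G_def by (intro DERIV_diff u')
  from MVT2[OF s this] obtain p where p: "0 < p" "p < s"
    and 1: "G s - G 0 = s * (fu (x + s *\<^sub>R v + p *\<^sub>R u) - fu (x + p *\<^sub>R u))"
    by auto
  from MVT2[OF s uv'[of "x + p *\<^sub>R u"]] obtain r where r: "0 < r" "r < s"
    and 2: "fu (x + p *\<^sub>R u + s *\<^sub>R v) - fu (x + p *\<^sub>R u) = s * fuv (x + p *\<^sub>R u + r *\<^sub>R v)"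
    by auto
  have "G s - G 0 = s * s * fuv (x + p *\<^sub>R u + r *\<^sub>R v)"
    using 1 2 by (simp add: algebra_simps)
  with p r show ?thesis
    unfolding G_def by (intro exI[of _ p] exI[of _ r]) (simp add: algebra_simps)
qed

lemma mixed_derivatives_commute_real:
  fixes f :: "'a::real_normed_vector \<Rightarrow> real"
  assumes u: "\<And>y. ((\<lambda>t. f (y + t *\<^sub>R u)) has_real_derivative fu y) (at 0)"
    and uv: "\<And>y. ((\<lambda>t. fu (y + t *\<^sub>R v)) has_real_derivative fuv y) (at 0)"
    and v: "\<And>y. ((\<lambda>t. f (y + t *\<^sub>R v)) has_real_derivative fv y) (at 0)"
    and vu: "\<And>y. ((\<lambda>t. fv (y + t *\<^sub>R u)) has_real_derivative fvu y) (at 0)"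
    and cont: "isCont fuv x" "isCont fvu x"
  shows "fuv x = fvu x"
proof (rule ccontr)
  assume ne: "fuv x \<noteq> fvu x"
  define e where "e = \<bar>fuv x - fvu x\<bar> / 2"
  have e: "e > 0" using ne by (simp add: e_def)
  obtain d1 where d1: "d1 > 0" "\<And>y. dist y x < d1 \<Longrightarrow> dist (fuv y) (fuv x) < e"
    using cont(1) e unfolding continuous_at_eps_delta by blast
  obtain d2 where d2: "d2 > 0" "\<And>y. dist y x < d2 \<Longrightarrow> dist (fvu y) (fvu x) < e"
    using cont(2) e unfolding continuous_at_eps_delta by blast
  define N where "N = norm u + norm v + 1"
  have N: "N > 0" by (simp add: N_def add_nonneg_pos)
  define s where "s = min d1 d2 / N"
  have s: "s > 0" using d1 d2 N by (simp add: s_def)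
  have near: "norm (p *\<^sub>R u + r *\<^sub>R v) < min d1 d2" if "0 < p" "p < s" "0 < r" "r < s" for p r
  proof -
    have "norm (p *\<^sub>R u + r *\<^sub>R v) \<le> p * norm u + r * norm v"
      using that by (metis norm_scaleR norm_triangle_ineq abs_of_pos)
    also have "\<dots> \<le> s * norm u + s * norm v"
      using that by (intro add_mono mult_right_mono) auto
    also have "\<dots> < s * N" using s by (simp add: N_def algebra_simps)
    also have "\<dots> = min d1 d2" using N by (simp add: s_def)
    finally show ?thesis .
  qed
  obtain p r where pr: "0 < p" "p < s" "0 < r" "r < s"
    and 1: "f (x + s *\<^sub>R u + s *\<^sub>R v) - f (x + s *\<^sub>R u) - f (x + s *\<^sub>R v) + f x
      = s * s * fuv (x + p *\<^sub>R u + r *\<^sub>R v)"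
    using second_difference_mvt[OF u uv s] by blast
  obtain p' r' where pr': "0 < p'" "p' < s" "0 < r'" "r' < s"
    and 2: "f (x + s *\<^sub>R v + s *\<^sub>R u) - f (x + s *\<^sub>R v) - f (x + s *\<^sub>R u) + f x
      = s * s * fvu (x + p' *\<^sub>R v + r' *\<^sub>R u)"
    using second_difference_mvt[OF v vu s] by blast
  have "s * s * fuv (x + p *\<^sub>R u + r *\<^sub>R v) = s * s * fvu (x + p' *\<^sub>R v + r' *\<^sub>R u)"
    using 1 2 by (simp add: algebra_simps)
  then have eq: "fuv (x + p *\<^sub>R u + r *\<^sub>R v) = fvu (x + p' *\<^sub>R v + r' *\<^sub>R u)"
    using s by simp
  have a: "dist (fuv (x + p *\<^sub>R u + r *\<^sub>R v)) (fuv x) < e"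
    using near[OF pr] by (intro d1) (simp add: dist_norm add.assoc)
  have b: "dist (fvu (x + p' *\<^sub>R v + r' *\<^sub>R u)) (fvu x) < e"
    using near[of r' p'] pr' by (intro d2) (simp add: dist_norm add.assoc add.commute)
  from a b eq show False unfolding e_def dist_real_def by (simp add: abs_if split: if_splits)
qed

lemma nderiv_swap:
  fixes f :: "'a::real_normed_vector \<Rightarrow> 'b::euclidean_space"
  assumes "smooth f"
  shows "nderiv f (u # v # vs) = nderiv f (v # u # vs)"
proof (rule ext, rule euclidean_eqI)
  fix x :: 'a and b :: 'b assume "b \<in> Basis"
  have line: "((\<lambda>t. nderiv f ws (y + t *\<^sub>R w) \<bullet> b) has_real_derivative nderiv f (w # ws) y \<bullet> b) (at 0)"
    for ws w y
  proof -
    let ?D = "frechet_derivative (nderiv f ws) (at y)"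
    have D: "(nderiv f ws has_derivative ?D) (at y)"
      using assms unfolding smooth_def frechet_derivative_works by blast
    have l: "((\<lambda>t::real. y + t *\<^sub>R w) has_derivative (\<lambda>t. t *\<^sub>R w)) (at 0)"
      by (auto intro!: derivative_eq_intros)
    have "((\<lambda>t. nderiv f ws (y + t *\<^sub>R w)) has_derivative (\<lambda>t. ?D (t *\<^sub>R w))) (at 0)"
      by (rule has_derivative_compose[OF l, of "nderiv f ws" ?D]) (simp only: scaleR_zero_left add_0_right D)
    then have "((\<lambda>t. nderiv f ws (y + t *\<^sub>R w) \<bullet> b) has_derivative (\<lambda>t. ?D (t *\<^sub>R w) \<bullet> b)) (at 0)"
      by (rule has_derivative_inner_left)
    moreover have "(\<lambda>t. ?D (t *\<^sub>R w) \<bullet> b) = (*) (?D w \<bullet> b)"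
      using linear_scale[OF has_derivative_linear[OF D]] by (auto simp: mult.commute)
    ultimately show ?thesis by (simp add: has_field_derivative_def)
  qed
  have cont: "isCont (\<lambda>x. nderiv f ws x \<bullet> b) x" for ws
    using assms differentiable_imp_continuous_within unfolding smooth_def
    by (intro continuous_inner continuous_const) blast
  show "nderiv f (u # v # vs) x \<bullet> b = nderiv f (v # u # vs) x \<bullet> b"
    by (rule mixed_derivatives_commute_real[where f = "\<lambda>x. nderiv f vs x \<bullet> b", OF line line line line cont cont])
qed

lemma nderiv_mset_cong:
  fixes f :: "'a::real_normed_vector \<Rightarrow> 'b::euclidean_space"
  assumes "smooth f" "mset vs = mset ws"
  shows "nderiv f vs = nderiv f ws"
proof -
  have front: "nderiv f (xs @ v # ys) = nderiv f (v # xs @ ys)" for v xs ys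
  proof (induction xs)
    case (Cons a xs)
    have "nderiv f (a # xs @ v # ys) = nderiv f (a # v # xs @ ys)"
      using Cons by (simp only: nderiv.simps)
    also have "\<dots> = nderiv f (v # a # xs @ ys)" by (rule nderiv_swap[OF assms(1)])
    finally show ?case by simp
  qed simp
  show ?thesis using assms(2)
  proof (induction vs arbitrary: ws)
    case (Cons v vs)
    then have "v \<in> set ws" by (metis list.set_intros(1) set_mset_mset)
    then obtain xs ys where ws: "ws = xs @ v # ys" by (auto dest: split_list)
    with Cons.prems have "mset vs = mset (xs @ ys)" by simp
    from Cons.IH[OF this] show ?case unfolding ws front by (simp only: nderiv.simps)
  qed simp
qed

lemma nderiv_mset_eq:
  fixes f :: "'a::real_normed_vector \<Rightarrow> 'b::euclidean_space"
  assumes "smooth f"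
  shows "nderiv_mset f (mset vs) x = nderiv f vs x"
proof -
  have "mset (SOME us. mset us = mset vs) = mset vs" by (rule someI) simp
  from nderiv_mset_cong[OF assms this] show ?thesis by (simp add: nderiv_mset_def)
qed

lemma eldiff_NodeG_mset:
  assumes "smooth (g m)"
  shows "eldiff A g (NodeG m (mset ts)) x = nderiv (g m) (map (\<lambda>\<tau>. eldiff A g \<tau> x) ts) x"
  using nderiv_mset_eq[OF assms, of "map (\<lambda>\<tau>. eldiff A g \<tau> x) ts" x]
  by (simp add: multiset.map_comp o_def)


section \<open>Formal series indexed by trees\<close>

text \<open>
  A formal series is represented by its family of real coefficients with respect to the symbols
  \<open>F(\<tau>)(x\<^sub>0)\<close>; \<open>series_term A g x\<^sub>0 S \<tau>\<close> is the vector that it contributes at \<open>\<tau>\<close>. Random coefficients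
  are handled for each outcome separately, so weights have type \<open>ctree \<Rightarrow> real\<close> here.
\<close>

definition series_term ::
  "real ^ 'd ^ 'd \<Rightarrow> (nat \<Rightarrow> real ^ 'd \<Rightarrow> real ^ 'd) \<Rightarrow> real ^ 'd \<Rightarrow> (ctree \<Rightarrow> real) \<Rightarrow> ctree \<Rightarrow> real ^ 'd"
  where "series_term A g x0 S \<tau> = S \<tau> *\<^sub>R eldiff A g \<tau> x0"

definition Bseries :: "(ctree \<Rightarrow> real) \<Rightarrow> ctree \<Rightarrow> real" where
  "Bseries \<phi> \<tau> = of_rat (alpha \<tau>) * \<phi> \<tau>"

text \<open>The series \<open>g\<^sub>m(B(\<phi>, x\<^sub>0; h))\<close>, obtained by formal Taylor expansion; it is supported on \<open>T\<^sub>m\<close>.\<close>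

definition g_Bseries :: "nat \<Rightarrow> (ctree \<Rightarrow> real) \<Rightarrow> ctree \<Rightarrow> real" where
  "g_Bseries m \<phi> \<tau> =
     (case \<tau> of
        NodeG k ts \<Rightarrow> if k = m then of_rat (alpha \<tau>) * prod_mset (image_mset \<phi> ts) else 0
      | _ \<Rightarrow> 0)"

text \<open>The series consisting of the single term \<open>x\<^sub>0 = F(\<emptyset>)(x\<^sub>0)\<close>.\<close>

definition start_series :: "ctree \<Rightarrow> real" where
  "start_series \<tau> = (if \<tau> = EmptyTree then 1 else 0)"

text \<open>
  Action of the power series \<open>\<Sum>\<^sub>q p\<^sub>q A\<^sup>q\<close> on a formal series, first on coefficients and then on
  the vectors, where \<open>A\<close> really acts. The term of index \<open>\<tau>\<close>, multiplied by \<open>A\<^sup>q\<close>, is placed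
  at the index \<open>graftA_pow q \<tau>\<close>. The sums are finite by \<open>finite_graftA_pow_decomps\<close>.
\<close>

definition matser_act :: "(nat \<Rightarrow> real) \<Rightarrow> (ctree \<Rightarrow> real) \<Rightarrow> ctree \<Rightarrow> real" where
  "matser_act p S \<sigma> = (\<Sum>(q, \<tau>)\<in>{(q, \<tau>). graftA_pow q \<tau> = \<sigma>}. p q * S \<tau>)"

definition matser_act_vec ::
  "real ^ 'd ^ 'd \<Rightarrow> (nat \<Rightarrow> real) \<Rightarrow> (ctree \<Rightarrow> real ^ 'd) \<Rightarrow> ctree \<Rightarrow> real ^ 'd" where
  "matser_act_vec A p V \<sigma> =
     (\<Sum>(q, \<tau>)\<in>{(q, \<tau>). graftA_pow q \<tau> = \<sigma>}. p q *\<^sub>R (((*v) A ^^ q) (V \<tau>)))"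

definition exp_ser :: "real \<Rightarrow> nat \<Rightarrow> real" where
  "exp_ser t q = t ^ q / fact q"

lemma size_graftA_pow: "size (graftA_pow q \<tau>) = q + size \<tau>"
  by (induction q) auto

lemma finite_graftA_pow_decomps: "finite {(q, \<tau>). graftA_pow q \<tau> = \<sigma>}"
proof (rule inj_on_finite[where f = fst and B = "{..size \<sigma>}"])
  have "inj (NodeA ^^ q)" for q
    by (induction q) (auto intro: inj_compose simp: inj_def)
  then show "inj_on fst {(q, \<tau>). graftA_pow q \<tau> = \<sigma>}"
    by (auto simp: inj_on_def inj_def)
qed (auto simp: size_graftA_pow)

lemma eldiff_graftA_pow: "eldiff A g (graftA_pow q \<tau>) x = ((*v) A ^^ q) (eldiff A g \<tau> x)"
  by (induction q) auto

text \<open>The two actions agree under the identification of \<open>A\<^sup>q F(\<tau>)(x\<^sub>0)\<close> with \<open>F(graftA_pow q \<tau>)(x\<^sub>0)\<close>.\<close>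

lemma series_term_matser_act:
  "series_term A g x0 (matser_act p S) = matser_act_vec A p (series_term A g x0 S)"
proof
  fix \<sigma>
  have scale: "((*v) A ^^ q) (r *\<^sub>R w) = r *\<^sub>R ((*v) A ^^ q) w" for q r w
    by (induction q) (auto simp: matrix_vector_mult_scaleR)
  show "series_term A g x0 (matser_act p S) \<sigma> = matser_act_vec A p (series_term A g x0 S) \<sigma>"
    unfolding series_term_def matser_act_def matser_act_vec_def scaleR_sum_left
    by (intro sum.cong) (auto simp: scale eldiff_graftA_pow)
qed

end

theory Submission
  imports Defs
begin

text \<open>
  The weights are read off from the recurrence by recursion on the tree, with the number \<open>q\<close> of
  nodes of colour \<open>A\<close> stripped from the root as an additional argument. The numerical solution is treated
  as a further stage of index \<open>0\<close>, with \<open>c\<^sub>0 = 1\<close> and \<open>Z\<^sub>0\<^sub>j = z\<^sub>j\<close>. The start series and the series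
  \<open>g\<^sub>m(B(\<phi>))\<close> have no terms at trees in \<open>T\<^sub>A\<close>, so a power series in \<open>A\<close> applied to one of them has
  exactly one contribution at \<open>[\<tau>]\<^sub>A\<^sup>q\<close>, \<open>\<tau> \<notin> T\<^sub>A\<close>, and both sides of the equations of the method
  can be compared term by term.
\<close>

primrec is_NodeA :: "ctree \<Rightarrow> bool" where
  "is_NodeA EmptyTree = False"
| "is_NodeA (NodeG m ts) = False"
| "is_NodeA (NodeA \<tau>) = True"

lemma graftA_pow_decomp: "\<exists>q \<tau>. \<sigma> = graftA_pow q \<tau> \<and> \<not> is_NodeA \<tau>"
proof (induction \<sigma>)
  case (NodeA \<sigma>)
  then obtain q \<tau> where "\<sigma> = graftA_pow q \<tau>" "\<not> is_NodeA \<tau>" by blast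
  then show ?case by (intro exI[of _ "Suc q"] exI[of _ \<tau>]) simp
qed (metis funpow_0 is_NodeA.simps)+

lemma graftA_pow_inject:
  assumes "graftA_pow q \<tau> = graftA_pow r \<sigma>" "\<not> is_NodeA \<tau>" "\<not> is_NodeA \<sigma>"
  shows "q = r \<and> \<tau> = \<sigma>"
  using assms(1)
proof (induction q arbitrary: r)
  case 0
  with assms(2) show ?case by (cases r) auto
next
  case (Suc q)
  with assms(3) obtain r' where "r = Suc r'" by (cases r) auto
  with Suc show ?case by auto
qed

lemma graftA_pow_mem_ctrees_iff: "graftA_pow q \<tau> \<in> ctrees M \<longleftrightarrow> \<tau> \<in> ctrees M"
  by (induction q) (auto intro: ctrees.intros elim: ctrees.cases)

lemma alpha_graftA_pow: "alpha (graftA_pow q \<tau>) = alpha \<tau>"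
  by (induction q) auto

text \<open>By uniqueness of the decomposition, any pair \<open>(q, \<tau>)\<close> other than
  \<open>(r, \<sigma>)\<close> in the sum has a root of colour \<open>A\<close>, where
  \<open>S\<close> vanishes.\<close>

lemma matser_act_graftA_pow:
  assumes S: "\<And>\<tau>. is_NodeA \<tau> \<Longrightarrow> S \<tau> = 0" and \<sigma>: "\<not> is_NodeA \<sigma>"
  shows "matser_act p S (graftA_pow r \<sigma>) = p r * S \<sigma>"
proof -
  have "matser_act p S (graftA_pow r \<sigma>) = (\<Sum>(q, \<tau>)\<in>{(r, \<sigma>)}. p q * S \<tau>)"
    unfolding matser_act_def
  proof (rule sum.mono_neutral_right[OF finite_graftA_pow_decomps])
    show "\<forall>x\<in>{(q, \<tau>). graftA_pow q \<tau> = graftA_pow r \<sigma>} - {(r, \<sigma>)}. (case x of (q, \<tau>) \<Rightarrow> p q * S \<tau>) = 0"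
      using graftA_pow_inject[OF _ _ \<sigma>] S by fastforce
  qed auto
  then show ?thesis by simp
qed

text \<open>The counter \<open>q\<close> and the stage \<open>i\<close> come after the tree, so that
  the recursion yields functions: a node of colour \<open>A\<close> only raises the counter, while
  the next node of colour \<open>m\<close> consumes it as the exponent in \<open>Z i j m q\<close>
  and restarts its subtrees at counter 0 and stage \<open>j\<close>.\<close>

primrec stage_weight ::
  "nat \<Rightarrow> (nat \<Rightarrow> real) \<Rightarrow> (nat \<Rightarrow> nat \<Rightarrow> nat \<Rightarrow> nat \<Rightarrow> real) \<Rightarrow> ctree \<Rightarrow> nat \<Rightarrow> nat \<Rightarrow> real" where
  "stage_weight \<nu> t Z EmptyTree = (\<lambda>q i. t i ^ q / fact q)"
| "stage_weight \<nu> t Z (NodeG m ts) = (\<lambda>q i.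
     \<Sum>j=1..\<nu>. Z i j m q * prod_mset (image_mset (\<lambda>f. f 0 j) (image_mset (stage_weight \<nu> t Z) ts)))"
| "stage_weight \<nu> t Z (NodeA \<tau>) = (\<lambda>q i. stage_weight \<nu> t Z \<tau> (Suc q) i)"

lemma stage_weight_graftA_pow:
  "stage_weight \<nu> t Z (graftA_pow q \<tau>) r i = stage_weight \<nu> t Z \<tau> (q + r) i"
  by (induction q arbitrary: r) auto

text \<open>Dropping empty trees from the list does not change the product, since the empty tree has
  weight \<open>t j ^ 0 / fact 0 = 1\<close> at counter 0.\<close>

lemma stage_weight_graft:
  "stage_weight \<nu> t Z (graft m ts) q i =
     (\<Sum>j=1..\<nu>. Z i j m q * (\<Prod>\<tau>\<leftarrow>ts. stage_weight \<nu> t Z \<tau> 0 j))"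
proof -
  have "prod_mset (image_mset (\<lambda>\<tau>. stage_weight \<nu> t Z \<tau> 0 j) (mset (filter (\<lambda>\<tau>. \<tau> \<noteq> EmptyTree) ts)))
      = (\<Prod>\<tau>\<leftarrow>ts. stage_weight \<nu> t Z \<tau> 0 j)" for j
    by (induction ts) auto
  then show ?thesis
    by (simp add: graft_def multiset.map_comp o_def)
qed

lemma stage_weight_measurable:
  assumes "\<tau> \<in> ctrees M" "i \<le> \<nu>"
    and Z: "\<And>i j m q. i \<le> \<nu> \<Longrightarrow> j \<in> {1..\<nu>} \<Longrightarrow> m \<le> M \<Longrightarrow> Z i j m q \<in> borel_measurable P"
  shows "(\<lambda>\<omega>. stage_weight \<nu> t (\<lambda>i j m q. Z i j m q \<omega>) \<tau> q i) \<in> borel_measurable P"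
  using assms(1,2)
proof (induction arbitrary: q i rule: ctrees.induct)
  case (2 m ts)
  \<comment> \<open>The outer induction hypothesis concerns only members of \<open>ts\<close>, so it
    passes to smaller multisets in an inner induction.\<close>
  have "(\<lambda>\<omega>. prod_mset (image_mset (\<lambda>\<tau>. stage_weight \<nu> t (\<lambda>i j m q. Z i j m q \<omega>) \<tau> 0 j) ts))
      \<in> borel_measurable P" if "j \<in> {1..\<nu>}" for j
    using 2(2)
  proof (induction ts)
    case (add \<tau> ts)
    then show ?case using that by (auto intro!: borel_measurable_times)
  qed simp
  with 2 Z show ?case
    by (auto simp: multiset.map_comp o_def intro!: borel_measurable_sum borel_measurable_times)
qed simp_all

text \<open>A node of colour \<open>m\<close> gives 0 at once through its coefficients. A chain of
  \<open>A\<close> nodes above the empty tree gives \<open>0 ^ q / fact q\<close>, which is 0 only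
  for positive \<open>q\<close>; the disjunction is the form of this condition that survives the
  descent through \<open>NodeA\<close>.\<close>

lemma stage_weight_eq_0:
  assumes "\<tau> \<in> ctrees M" "t i = 0" "\<And>j m q. j \<in> {1..\<nu>} \<Longrightarrow> m \<le> M \<Longrightarrow> Z i j m q = 0"
    and "q > 0 \<or> \<tau> \<noteq> EmptyTree"
  shows "stage_weight \<nu> t Z \<tau> q i = 0"
  using assms by (induction arbitrary: q rule: ctrees.induct) auto

lemma g_Bseries_NodeA: "is_NodeA \<tau> \<Longrightarrow> g_Bseries m \<phi> \<tau> = 0"
  by (cases \<tau>) (auto simp: g_Bseries_def)

lemma start_series_NodeA: "is_NodeA \<tau> \<Longrightarrow> start_series \<tau> = 0"
  by (cases \<tau>) (auto simp: start_series_def)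

lemma Bseries_stage_weight:
  assumes "\<tau> \<in> ctrees M"
  shows "Bseries (\<lambda>\<tau>. stage_weight \<nu> t Z \<tau> 0 i) \<tau> =
    matser_act (exp_ser (t i)) start_series \<tau> +
    (\<Sum>m=0..M. \<Sum>j=1..\<nu>.
       matser_act (Z i j m) (g_Bseries m (\<lambda>\<tau>. stage_weight \<nu> t Z \<tau> 0 j)) \<tau>)"
proof -
  obtain q \<sigma> where \<tau>: "\<tau> = graftA_pow q \<sigma>" and \<sigma>: "\<not> is_NodeA \<sigma>"
    using graftA_pow_decomp by blast
  have mem: "\<sigma> \<in> ctrees M"
    using assms by (simp add: \<tau> graftA_pow_mem_ctrees_iff)
  have act: "matser_act p start_series \<tau> = p q * start_series \<sigma>"
    "matser_act p (g_Bseries m \<phi>) \<tau> = p q * g_Bseries m \<phi> \<sigma>" for p m \<phi>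
    unfolding \<tau> using \<sigma> start_series_NodeA g_Bseries_NodeA by (intro matser_act_graftA_pow; blast)+
  have lhs: "Bseries (\<lambda>\<tau>. stage_weight \<nu> t Z \<tau> 0 i) \<tau> = of_rat (alpha \<sigma>) * stage_weight \<nu> t Z \<sigma> q i"
    by (simp add: Bseries_def \<tau> alpha_graftA_pow stage_weight_graftA_pow)
  show ?thesis
  proof (cases \<sigma>)
    case EmptyTree
    then show ?thesis
      unfolding lhs act by (simp add: start_series_def g_Bseries_def exp_ser_def)
  next
    case (NodeG k ts)
    with mem have k: "k \<le> M" by (auto elim: ctrees.cases)
    let ?G = "\<lambda>m j. Z i j m q * g_Bseries m (\<lambda>\<tau>. stage_weight \<nu> t Z \<tau> 0 j) \<sigma>"
    \<comment> \<open>Each series of \<open>g_Bseries m\<close> is supported on roots of colour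
      \<open>m\<close>, so only the colour \<open>k\<close> of the root of \<open>\<sigma>\<close>
      contributes.\<close>
    have "(\<Sum>m=0..M. \<Sum>j=1..\<nu>. ?G m j) = (\<Sum>m=0..M. if m = k then \<Sum>j=1..\<nu>. ?G k j else 0)"
      by (intro sum.cong) (auto simp: NodeG g_Bseries_def)
    also have "\<dots> = (\<Sum>j=1..\<nu>. ?G k j)"
      using k by simp
    \<comment> \<open>Both sides carry the same factor \<open>alpha \<sigma>\<close>; keeping it
      folded avoids any computation with symmetry coefficients.\<close>
    also have "\<dots> = of_rat (alpha \<sigma>) * stage_weight \<nu> t Z \<sigma> q i"
      by (simp add: NodeG g_Bseries_def sum_distrib_left multiset.map_comp o_def mult_ac del: alpha.simps)
    finally show ?thesis
      unfolding lhs act by (simp add: NodeG start_series_def)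
  next
    case (NodeA \<sigma>')
    with \<sigma> show ?thesis by simp
  qed
qed

text \<open>The two actions of a power series in \<open>A\<close> agree under
  \<open>series_term\<close>, which is linear in the coefficients, so the coefficient identity
  carries over to vectors.\<close>

lemma series_term_Bseries_stage_weight:
  assumes "\<tau> \<in> ctrees M"
  shows "series_term A g x0 (Bseries (\<lambda>\<tau>. stage_weight \<nu> t Z \<tau> 0 i)) \<tau> =
    matser_act_vec A (exp_ser (t i)) (series_term A g x0 start_series) \<tau> +
    (\<Sum>m=0..M. \<Sum>j=1..\<nu>. matser_act_vec A (Z i j m)
       (series_term A g x0 (g_Bseries m (\<lambda>\<tau>. stage_weight \<nu> t Z \<tau> 0 j))) \<tau>)"
  unfolding series_term_matser_act[symmetric] series_term_def Bseries_stage_weight[OF assms]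
  by (simp add: scaleR_add_left scaleR_sum_left)

theorem theorem2:
  fixes P :: "'w measure"
    and M \<nu> :: nat
    and A :: "real ^ 'd ^ 'd"
    and g :: "nat \<Rightarrow> real ^ 'd \<Rightarrow> real ^ 'd"
    and c :: "nat \<Rightarrow> real"
    and Z :: "nat \<Rightarrow> nat \<Rightarrow> nat \<Rightarrow> nat \<Rightarrow> real \<Rightarrow> 'w \<Rightarrow> real"
    and z :: "nat \<Rightarrow> nat \<Rightarrow> nat \<Rightarrow> real \<Rightarrow> 'w \<Rightarrow> real"
    and Yn :: "real ^ 'd"
  assumes "prob_space P"
    and "M \<ge> 1" and "\<nu> \<ge> 1"
    and "\<And>m. m \<le> M \<Longrightarrow> smooth (g m)"
    and "\<And>i j m q h. i \<in> {1..\<nu>} \<Longrightarrow> j \<in> {1..\<nu>} \<Longrightarrow> m \<le> M \<Longrightarrow> Z i j m q h \<in> borel_measurable P"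
    and "\<And>i m q h. i \<in> {1..\<nu>} \<Longrightarrow> m \<le> M \<Longrightarrow> z i m q h \<in> borel_measurable P"
  shows "\<exists>(\<Phi>s :: nat \<Rightarrow> ctree \<Rightarrow> real \<Rightarrow> 'w \<Rightarrow> real) (\<Phi> :: ctree \<Rightarrow> real \<Rightarrow> 'w \<Rightarrow> real).
    \<comment> \<open>the weights are random variables\<close>
    (\<forall>i\<in>{1..\<nu>}. \<forall>\<tau>\<in>ctrees M. \<forall>h. \<Phi>s i \<tau> h \<in> borel_measurable P) \<and>
    (\<forall>\<tau>\<in>ctrees M. \<forall>h. \<Phi> \<tau> h \<in> borel_measurable P) \<and>
    \<comment> \<open>the weights vanish at step size zero if the coefficients of the method do\<close>
    (\<forall>\<omega>. (\<forall>i\<in>{1..\<nu>}. \<forall>j\<in>{1..\<nu>}. \<forall>m\<le>M. \<forall>q. Z i j m q 0 \<omega> = 0) \<longrightarrow>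
       (\<forall>i\<in>{1..\<nu>}. \<forall>\<tau>\<in>ctrees M - {EmptyTree}. \<Phi>s i \<tau> 0 \<omega> = 0)) \<and>
    (\<forall>\<omega>. (\<forall>i\<in>{1..\<nu>}. \<forall>m\<le>M. \<forall>q. z i m q 0 \<omega> = 0) \<longrightarrow>
       (\<forall>\<tau>\<in>ctrees M - {EmptyTree}. \<Phi> \<tau> 0 \<omega> = 0)) \<and>
    \<comment> \<open>recurrence relations\<close>
    (\<forall>i\<in>{1..\<nu>}. \<forall>h \<omega>. \<Phi>s i EmptyTree h \<omega> = 1) \<and>
    (\<forall>h \<omega>. \<Phi> EmptyTree h \<omega> = 1) \<and>
    (\<forall>i\<in>{1..\<nu>}. \<forall>q h \<omega>. \<Phi>s i (graftA_pow q EmptyTree) h \<omega> = (c i * h) ^ q / fact q) \<and>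
    (\<forall>q h \<omega>. \<Phi> (graftA_pow q EmptyTree) h \<omega> = h ^ q / fact q) \<and>
    (\<forall>i\<in>{1..\<nu>}. \<forall>m\<le>M. \<forall>q ts h \<omega>.
       set ts \<subseteq> ctrees M \<and> (length ts > 1 \<longrightarrow> EmptyTree \<notin> set ts) \<longrightarrow>
       \<Phi>s i (graftA_pow q (graft m ts)) h \<omega> =
         (\<Sum>j=1..\<nu>. Z i j m q h \<omega> * (\<Prod>\<tau>\<leftarrow>ts. \<Phi>s j \<tau> h \<omega>))) \<and>
    (\<forall>m\<le>M. \<forall>q ts h \<omega>.
       set ts \<subseteq> ctrees M \<and> (length ts > 1 \<longrightarrow> EmptyTree \<notin> set ts) \<longrightarrow>
       \<Phi> (graftA_pow q (graft m ts)) h \<omega> =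
         (\<Sum>i=1..\<nu>. z i m q h \<omega> * (\<Prod>\<tau>\<leftarrow>ts. \<Phi>s i \<tau> h \<omega>))) \<and>
    \<comment> \<open>the equations of the method, as identities between coefficients of \<open>F(\<tau>)(Y\<^sub>n)\<close>\<close>
    (\<forall>i\<in>{1..\<nu>}. \<forall>h \<omega>. \<forall>\<tau>\<in>ctrees M.
       Bseries (\<lambda>\<tau>. \<Phi>s i \<tau> h \<omega>) \<tau> =
         matser_act (exp_ser (c i * h)) start_series \<tau> +
         (\<Sum>m=0..M. \<Sum>j=1..\<nu>.
            matser_act (\<lambda>q. Z i j m q h \<omega>) (g_Bseries m (\<lambda>\<tau>. \<Phi>s j \<tau> h \<omega>)) \<tau>)) \<and>
    (\<forall>h \<omega>. \<forall>\<tau>\<in>ctrees M.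
       Bseries (\<lambda>\<tau>. \<Phi> \<tau> h \<omega>) \<tau> =
         matser_act (exp_ser h) start_series \<tau> +
         (\<Sum>m=0..M. \<Sum>i=1..\<nu>.
            matser_act (\<lambda>q. z i m q h \<omega>) (g_Bseries m (\<lambda>\<tau>. \<Phi>s i \<tau> h \<omega>)) \<tau>)) \<and>
    \<comment> \<open>the equations of the method, as identities between vectors, with \<open>A\<close> acting on them\<close>
    (\<forall>i\<in>{1..\<nu>}. \<forall>h \<omega>. \<forall>\<tau>\<in>ctrees M.
       series_term A g Yn (Bseries (\<lambda>\<tau>. \<Phi>s i \<tau> h \<omega>)) \<tau> =
         matser_act_vec A (exp_ser (c i * h)) (series_term A g Yn start_series) \<tau> +
         (\<Sum>m=0..M. \<Sum>j=1..\<nu>.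
            matser_act_vec A (\<lambda>q. Z i j m q h \<omega>)
              (series_term A g Yn (g_Bseries m (\<lambda>\<tau>. \<Phi>s j \<tau> h \<omega>))) \<tau>)) \<and>
    (\<forall>h \<omega>. \<forall>\<tau>\<in>ctrees M.
       series_term A g Yn (Bseries (\<lambda>\<tau>. \<Phi> \<tau> h \<omega>)) \<tau> =
         matser_act_vec A (exp_ser h) (series_term A g Yn start_series) \<tau> +
         (\<Sum>m=0..M. \<Sum>i=1..\<nu>.
            matser_act_vec A (\<lambda>q. z i m q h \<omega>)
              (series_term A g Yn (g_Bseries m (\<lambda>\<tau>. \<Phi>s i \<tau> h \<omega>))) \<tau>))"
proof -
  \<comment> \<open>Index 0 is free for the numerical solution: all sums over stages start at 1, so
    this extra stage never feeds into the others.\<close>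
  define c' where "c' = c(0 := 1)"
  define Z' where "Z' = Z(0 := z)"
  define W where "W h \<omega> = stage_weight \<nu> (\<lambda>i. c' i * h) (\<lambda>i j m q. Z' i j m q h \<omega>)" for h \<omega>
  have c': "c' 0 = 1" "\<And>i. i \<in> {1..\<nu>} \<Longrightarrow> c' i = c i"
    by (auto simp: c'_def)
  have Z': "Z' 0 = z" "\<And>i. i \<in> {1..\<nu>} \<Longrightarrow> Z' i = Z i"
    by (auto simp: Z'_def)
  have Z'_meas: "Z' i j m q h \<in> borel_measurable P" if "i \<le> \<nu>" "j \<in> {1..\<nu>}" "m \<le> M" for i j m q h
    using assms(5,6) that by (cases "i = 0") (auto simp: Z'_def)
  have meas: "(\<lambda>\<omega>. W h \<omega> \<tau> 0 i) \<in> borel_measurable P" if "i \<le> \<nu>" "\<tau> \<in> ctrees M" for i \<tau> h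
    unfolding W_def
    using that by (intro stage_weight_measurable[where Z = "\<lambda>i j m q. Z' i j m q h"] Z'_meas)
  \<comment> \<open>At step size 0 every \<open>c' i * h\<close> is 0, including the one of the
    extra stage.\<close>
  have vanish: "W 0 \<omega> \<tau> 0 i = 0"
    if "\<forall>j\<in>{1..\<nu>}. \<forall>m\<le>M. \<forall>q. Z' i j m q 0 \<omega> = 0" "\<tau> \<in> ctrees M - {EmptyTree}" for i \<omega> \<tau>
    unfolding W_def using that by (intro stage_weight_eq_0[where M = M]) auto
  have empty: "W h \<omega> EmptyTree 0 i = 1" for h \<omega> i
    by (simp add: W_def)
  have expo: "W h \<omega> (graftA_pow q EmptyTree) 0 i = (c' i * h) ^ q / fact q" for h \<omega> q i
    by (simp add: W_def stage_weight_graftA_pow)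
  have recur: "W h \<omega> (graftA_pow q (graft m ts)) 0 i =
      (\<Sum>j=1..\<nu>. Z' i j m q h \<omega> * (\<Prod>\<tau>\<leftarrow>ts. W h \<omega> \<tau> 0 j))" for h \<omega> q m ts i
    by (simp add: W_def stage_weight_graftA_pow stage_weight_graft)
  note coeff = Bseries_stage_weight[of _ M \<nu> "\<lambda>i. c' i * h" "\<lambda>i j m q. Z' i j m q h \<omega>" for h \<omega>,
      folded W_def]
  note vec = series_term_Bseries_stage_weight[of _ M A g Yn \<nu> "\<lambda>i. c' i * h"
      "\<lambda>i j m q. Z' i j m q h \<omega>" for h \<omega>, folded W_def]
  show ?thesis
    apply (rule exI[of _ "\<lambda>i \<tau> h \<omega>. W h \<omega> \<tau> 0 i"])
    apply (rule exI[of _ "\<lambda>\<tau> h \<omega>. W h \<omega> \<tau> 0 0"])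
    apply (intro conjI)
    subgoal using meas by auto
    subgoal using meas by auto
    subgoal using vanish by (auto simp: Z')
    subgoal using vanish by (auto simp: Z')
    subgoal by (simp add: empty)
    subgoal by (simp add: empty)
    subgoal by (simp add: expo c')
    subgoal by (simp add: expo c')
    \<comment> \<open>Membership in \<open>{1..\<nu>}\<close> stays folded to match the premises of
      the conditional equations \<open>c'\<close> and \<open>Z'\<close>.\<close>
    subgoal by (simp add: recur Z' del: atLeastAtMost_iff)
    subgoal by (simp add: recur Z' del: atLeastAtMost_iff)
    subgoal by (simp add: coeff c' Z' del: atLeastAtMost_iff)
    subgoal by (simp add: coeff c' Z' del: atLeastAtMost_iff)
    subgoal by (simp add: vec c' Z' del: atLeastAtMost_iff)
    subgoal by (simp add: vec c' Z' del: atLeastAtMost_iff)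
    done
qed

end
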